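(* Let $(M,E)$ be a Finsler manifold, and let $V$ and $U$ be two vertical vector fields on $TM$ homogeneous of degree $2$ (i.e. $[C,V]=V$ and $[C,U]=U$). Put $\overset{V}{S}:=S_0+2V+2(d_{[J,V]}E)^{\#}$ and $\overset{U}{S}:=S_0+2U+2(d_{[J,U]}E)^{\#}$. Suppose that the sprays $\overset{V}{S}$ and $\overset{U}{S}$ are projectively related with projective factor $\lambda$, i.e. $\lambda$ is a smooth function on $\overset{\circ}{T}M$ with $\overset{V}{S}=\overset{U}{S}+\lambda C$ over $\overset{\circ}{T}M$. Then $$\lambda=\frac{3\,(V-U)E}{E}\quad\text{over }\overset{\circ}{T}M.$$
   Context: $M$ is a connected smooth $n$-dimensional manifold (Hausdorff, countable base), $TM$ its tangent bundle, $\overset{\circ}{T}M\subset TM$ the open submanifold of nonzero tangent vectors. $C$ is the Liouville vector field on $TM$ and $J$ is the vertical endomorphism of $TM$ (the $(1,1)$ tensor with image and kernel the vertical vector fields, $[J,J]=0$, $[J,C]=J$). A vector $1$-form is a $(1,1)$ tensor field. For a vector $1$-form $K$ and a function $\varphi$, $d_K\varphi:=d\varphi\circ K$. For a vector field $Y$, $[K,Y]$ is the vector $1$-form $[K,Y]X=[KX,Y]-K[X,Y]$. A spray is a vector field $S$ with $JS=C$ and $[C,S]=S$. A Finsler manifold $(M,E)$: $E:TM\to\mathbb{R}$ with $E(0)=0$, $E>0$ on $\overset{\circ}{T}M$, $E$ of class $C^1$ on $TM$ and smooth on $\overset{\circ}{T}M$, $E$ positively homogeneous of degree $2$ ($CE=2E$),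 and the fundamental $2$-form $\omega:=d\,d_JE$ nondegenerate. For a $1$-form $\beta$, $\beta^{\#}$ is the unique vector field (smooth in general only on $\overset{\circ}{T}M$) with $i_{\beta^{\#}}\omega=\beta$. The canonical spray is $S_0:=-(dE)^{\#}$ over $\overset{\circ}{T}M$, $S_0(0):=0$. $(V-U)E$ denotes the derivative of $E$ along $V-U$. *)

theory Defs
  imports "HOL-Analysis.Analysis"
begin

section \<open>Maps of class \<open>C^k\<close> between Euclidean spaces\<close>

text \<open>Meant for open \<open>S\<close>. Differentiability together with directional derivatives of
  class \<open>C^k\<close> is, in finite dimension, the same as being of class \<open>C^(k+1)\<close>.\<close>

primrec Ck_on :: "nat \<Rightarrow> 'a::euclidean_space set \<Rightarrow> ('a \<Rightarrow> 'b::real_normed_vector) \<Rightarrow> bool" where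
  "Ck_on 0 S f \<longleftrightarrow> continuous_on S f"
| "Ck_on (Suc k) S f \<longleftrightarrow>
     (\<forall>x\<in>S. f differentiable (at x)) \<and> (\<forall>v. Ck_on k S (\<lambda>x. frechet_derivative f (at x) v))"

definition smooth_on :: "'a::euclidean_space set \<Rightarrow> ('a \<Rightarrow> 'b::real_normed_vector) \<Rightarrow> bool" where
  "smooth_on S f \<longleftrightarrow> (\<forall>k. Ck_on k S f)"

section \<open>Manifolds given by atlases\<close>

text \<open>A chart is a pair of its domain and its coordinate map; values of the coordinate map
  outside the domain are irrelevant.\<close>

type_synonym ('a, 'e) chart = "'a set \<times> ('a \<Rightarrow> 'e)"

definition in_chart :: "('a, 'e) chart \<Rightarrow> ('a \<Rightarrow> 'b) \<Rightarrow> 'e \<Rightarrow> 'b" where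
  "in_chart c f = f \<circ> inv_into (fst c) (snd c)"

definition smooth_manifold :: "'a topology \<Rightarrow> ('a, 'e::euclidean_space) chart set \<Rightarrow> bool" where
  "smooth_manifold M A \<longleftrightarrow>
     Hausdorff_space M \<and> second_countable M \<and>
     (\<Union>c\<in>A. fst c) = topspace M \<and>
     (\<forall>c\<in>A. openin M (fst c) \<and> open (snd c ` fst c) \<and>
        homeomorphic_map (subtopology M (fst c)) (top_of_set (snd c ` fst c)) (snd c)) \<and>
     (\<forall>c\<in>A. \<forall>d\<in>A. smooth_on (snd c ` (fst c \<inter> fst d)) (in_chart c (snd d)))"

text \<open>Functions of class \<open>C^k\<close> on an open subset \<open>W\<close> of the manifold.\<close>

definition manifold_Ck_on ::
    "('a, 'e::euclidean_space) chart set \<Rightarrow> nat \<Rightarrow> 'a set \<Rightarrow> ('a \<Rightarrow> real) \<Rightarrow> bool" where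
  "manifold_Ck_on A k W f \<longleftrightarrow> (\<forall>c\<in>A. Ck_on k (snd c ` (fst c \<inter> W)) (in_chart c f))"

definition manifold_smooth_on ::
    "('a, 'e::euclidean_space) chart set \<Rightarrow> 'a set \<Rightarrow> ('a \<Rightarrow> real) \<Rightarrow> bool" where
  "manifold_smooth_on A W f \<longleftrightarrow> (\<forall>c\<in>A. smooth_on (snd c ` (fst c \<inter> W)) (in_chart c f))"

section \<open>Tangent vectors and the tangent bundle\<close>

text \<open>A tangent vector at \<open>p\<close> is the family of its components with respect to all charts of the
  atlas around \<open>p\<close>, obeying the transformation law of contravariant vectors. The components at
  all other indices are set to 0, so that equality of tangent vectors is equality of families
  and the vector space operations are pointwise.\<close>

type_synonym ('a, 'e) tvec = "('a, 'e) chart \<Rightarrow> 'e"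

definition tangent_space :: "('a, 'e::euclidean_space) chart set \<Rightarrow> 'a \<Rightarrow> ('a, 'e) tvec set" where
  "tangent_space A p =
     {v. (\<forall>c\<in>A. \<forall>d\<in>A. p \<in> fst c \<inter> fst d \<longrightarrow>
            v d = frechet_derivative (in_chart c (snd d)) (at (snd c p)) (v c)) \<and>
         (\<forall>c. c \<notin> A \<or> p \<notin> fst c \<longrightarrow> v c = 0)}"

definition tangent_bundle ::
    "('a, 'e::euclidean_space) chart set \<Rightarrow> ('a \<times> ('a, 'e) tvec) set" where
  "tangent_bundle A = (SIGMA p:(\<Union>c\<in>A. fst c). tangent_space A p)"

text \<open>The tangent bundle with the zero section removed.\<close>

definition slit_bundle ::
    "('a, 'e::euclidean_space) chart set \<Rightarrow> ('a \<times> ('a, 'e) tvec) set" where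
  "slit_bundle A = {z \<in> tangent_bundle A. snd z \<noteq> (\<lambda>_. 0)}"

text \<open>A chart of the manifold induces the chart \<open>(p, v) \<mapsto> (x, y)\<close> of the tangent bundle, where
  \<open>x\<close> are the coordinates of \<open>p\<close> and \<open>y\<close> the components of \<open>v\<close>. These charts make the tangent
  bundle a manifold modelled on \<open>'e \<times> 'e\<close>, so everything below applies to it as well.\<close>

definition tangent_chart :: "('a, 'e::euclidean_space) chart set \<Rightarrow> ('a, 'e) chart \<Rightarrow>
    ('a \<times> ('a, 'e) tvec, 'e \<times> 'e) chart" where
  "tangent_chart A c = ({z \<in> tangent_bundle A. fst z \<in> fst c}, \<lambda>z. (snd c (fst z), snd z c))"

definition tangent_atlas :: "('a, 'e::euclidean_space) chart set \<Rightarrow>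
    ('a \<times> ('a, 'e) tvec, 'e \<times> 'e) chart set" where
  "tangent_atlas A = tangent_chart A ` A"

section \<open>Calculus on a manifold\<close>

definition chart_at :: "('a, 'e) chart set \<Rightarrow> 'a \<Rightarrow> ('a, 'e) chart" where
  "chart_at A p = (SOME c. c \<in> A \<and> p \<in> fst c)"

text \<open>\<open>differential A f p v\<close> is the derivative of \<open>f\<close> along \<open>v\<close>. By the chain rule the choice of
  the chart does not matter.\<close>

definition differential ::
    "('a, 'e::euclidean_space) chart set \<Rightarrow> ('a \<Rightarrow> real) \<Rightarrow> 'a \<Rightarrow> ('a, 'e) tvec \<Rightarrow> real" where
  "differential A f p v =
     (let c = chart_at A p in frechet_derivative (in_chart c f) (at (snd c p)) (v c))"

definition smooth_vector_field_on ::
    "('a, 'e::euclidean_space) chart set \<Rightarrow> 'a set \<Rightarrow> ('a \<Rightarrow> ('a, 'e) tvec) \<Rightarrow> bool" where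
  "smooth_vector_field_on A W X \<longleftrightarrow>
     (\<forall>p\<in>W. X p \<in> tangent_space A p) \<and>
     (\<forall>c\<in>A. smooth_on (snd c ` (fst c \<inter> W)) (in_chart c (\<lambda>p. X p c)))"

text \<open>In every chart, \<open>[X, Y]\<close> has the components \<open>DY(X) - DX(Y)\<close>, that is,
  \<open>[X, Y] f = X (Y f) - Y (X f)\<close>.\<close>

definition lie_bracket :: "('a, 'e::euclidean_space) chart set \<Rightarrow>
    ('a \<Rightarrow> ('a, 'e) tvec) \<Rightarrow> ('a \<Rightarrow> ('a, 'e) tvec) \<Rightarrow> 'a \<Rightarrow> ('a, 'e) tvec" where
  "lie_bracket A X Y p = (\<lambda>c. if c \<in> A \<and> p \<in> fst c
     then frechet_derivative (in_chart c (\<lambda>q. Y q c)) (at (snd c p)) (X p c)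
        - frechet_derivative (in_chart c (\<lambda>q. X q c)) (at (snd c p)) (Y p c)
     else 0)"

text \<open>The vector field on the domain of the chart \<open>c\<close> with constant components \<open>w\<close> in \<open>c\<close>.\<close>

definition coord_field ::
    "('a, 'e::euclidean_space) chart set \<Rightarrow> ('a, 'e) chart \<Rightarrow> 'e \<Rightarrow> 'a \<Rightarrow> ('a, 'e) tvec" where
  "coord_field A c w p = (\<lambda>d. if d \<in> A \<and> p \<in> fst d
     then frechet_derivative (in_chart c (snd d)) (at (snd c p)) w else 0)"

text \<open>A vector field near \<open>p\<close> with value \<open>v\<close> at \<open>p\<close>.\<close>

definition local_extension ::
    "('a, 'e::euclidean_space) chart set \<Rightarrow> 'a \<Rightarrow> ('a, 'e) tvec \<Rightarrow> 'a \<Rightarrow> ('a, 'e) tvec" where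
  "local_extension A p v = coord_field A (chart_at A p) (v (chart_at A p))"

text \<open>Differential forms and vector 1-forms are given pointwise, as functions of a point and of
  tangent vectors there.\<close>

type_synonym ('a, 'e) form1 = "'a \<Rightarrow> ('a, 'e) tvec \<Rightarrow> real"
type_synonym ('a, 'e) form2 = "'a \<Rightarrow> ('a, 'e) tvec \<Rightarrow> ('a, 'e) tvec \<Rightarrow> real"
type_synonym ('a, 'e) vector_form1 = "'a \<Rightarrow> ('a, 'e) tvec \<Rightarrow> ('a, 'e) tvec"

text \<open>\<open>d\<beta>(X, Y) = X \<beta>(Y) - Y \<beta>(X) - \<beta>([X, Y])\<close>, evaluated on two vector fields with constant
  components in the same chart, for which the last term vanishes.\<close>

definition ext_deriv ::
    "('a, 'e::euclidean_space) chart set \<Rightarrow> ('a, 'e) form1 \<Rightarrow> ('a, 'e) form2" where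
  "ext_deriv A \<beta> p v w =
     differential A (\<lambda>q. \<beta> q (local_extension A p w q)) p v
   - differential A (\<lambda>q. \<beta> q (local_extension A p v q)) p w"

text \<open>The 1-form \<open>d_K f = df \<circ> K\<close>.\<close>

definition differential_along ::
    "('a, 'e::euclidean_space) chart set \<Rightarrow> ('a, 'e) vector_form1 \<Rightarrow> ('a \<Rightarrow> real) \<Rightarrow> ('a, 'e) form1"
  where "differential_along A K f p v = differential A f p (K p v)"

text \<open>The vector 1-form \<open>[K, Y]\<close> with \<open>[K, Y] X = [K X, Y] - K [X, Y]\<close>. The right-hand side is
  tensorial in \<open>X\<close>, so its value on a tangent vector may be computed from any local extension.\<close>

definition vector_form_bracket :: "('a, 'e::euclidean_space) chart set \<Rightarrow>
    ('a, 'e) vector_form1 \<Rightarrow> ('a \<Rightarrow> ('a, 'e) tvec) \<Rightarrow> ('a, 'e) vector_form1" where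
  "vector_form_bracket A K Y p v = (let X = local_extension A p v in
     (\<lambda>c. lie_bracket A (\<lambda>q. K q (X q)) Y p c - K p (lie_bracket A X Y p) c))"

definition nondegenerate_at ::
    "('a, 'e::euclidean_space) chart set \<Rightarrow> ('a, 'e) form2 \<Rightarrow> 'a \<Rightarrow> bool" where
  "nondegenerate_at A \<omega> p \<longleftrightarrow>
     (\<forall>v\<in>tangent_space A p. (\<forall>w\<in>tangent_space A p. \<omega> p v w = 0) \<longrightarrow> v = (\<lambda>_. 0))"

text \<open>The vector field \<open>\<beta>\<^sup>#\<close> with \<open>\<omega>(\<beta>\<^sup>#, \<cdot>) = \<beta>\<close>, at points where \<open>\<omega>\<close> is nondegenerate.\<close>

definition sharp :: "('a, 'e::euclidean_space) chart set \<Rightarrow> ('a, 'e) form2 \<Rightarrow> ('a, 'e) form1 \<Rightarrow>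
    'a \<Rightarrow> ('a, 'e) tvec" where
  "sharp A \<omega> \<beta> p =
     (THE v. v \<in> tangent_space A p \<and> (\<forall>w\<in>tangent_space A p. \<omega> p v w = \<beta> p w))"

section \<open>Canonical objects on the tangent bundle\<close>

text \<open>A tangent vector of the tangent bundle has components \<open>(a, b)\<close> with respect to an induced
  chart \<open>(x, y)\<close>; it is vertical iff it is annihilated by the tangent map of the bundle
  projection, i.e. \<open>a = 0\<close>. In every induced chart the Liouville field is
  \<open>y \<partial>/\<partial>y\<close>, and the vertical endomorphism is \<open>dx \<otimes> \<partial>/\<partial>y\<close>, i.e. \<open>(a, b) \<mapsto> (0, a)\<close>.\<close>

definition vertical_vector :: "('b, 'e::euclidean_space \<times> 'e) tvec \<Rightarrow> bool" where
  "vertical_vector v \<longleftrightarrow> (\<forall>c. fst (v c) = 0)"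

definition liouville :: "('a, 'e::euclidean_space) chart set \<Rightarrow>
    'a \<times> ('a, 'e) tvec \<Rightarrow> ('a \<times> ('a, 'e) tvec, 'e \<times> 'e) tvec" where
  "liouville A z =
     (\<lambda>c. if c \<in> tangent_atlas A \<and> z \<in> fst c then (0, snd (snd c z)) else 0)"

definition vertical_endo :: "('b, 'e::euclidean_space \<times> 'e) vector_form1" where
  "vertical_endo z v = (\<lambda>c. (0, fst (v c)))"

text \<open>As usual in Finsler geometry, smoothness is only required away from the zero section,
  and the bracket condition \<open>[C, V] = V\<close> is correspondingly imposed there.\<close>

definition vertical_field :: "('a, 'e::euclidean_space) chart set \<Rightarrow>
    ('a \<times> ('a, 'e) tvec \<Rightarrow> ('a \<times> ('a, 'e) tvec, 'e \<times> 'e) tvec) \<Rightarrow> bool" where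
  "vertical_field A V \<longleftrightarrow>
     (\<forall>z\<in>tangent_bundle A. V z \<in> tangent_space (tangent_atlas A) z \<and> vertical_vector (V z)) \<and>
     smooth_vector_field_on (tangent_atlas A) (slit_bundle A) V"

definition homogeneous_field_2 :: "('a, 'e::euclidean_space) chart set \<Rightarrow>
    ('a \<times> ('a, 'e) tvec \<Rightarrow> ('a \<times> ('a, 'e) tvec, 'e \<times> 'e) tvec) \<Rightarrow> bool" where
  "homogeneous_field_2 A V \<longleftrightarrow>
     (\<forall>z\<in>slit_bundle A. lie_bracket (tangent_atlas A) (liouville A) V z = V z)"

section \<open>Finsler manifolds\<close>

definition fundamental_form :: "('a, 'e::euclidean_space) chart set \<Rightarrow>
    ('a \<times> ('a, 'e) tvec \<Rightarrow> real) \<Rightarrow> ('a \<times> ('a, 'e) tvec, 'e \<times> 'e) form2" where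
  "fundamental_form A E =
     ext_deriv (tangent_atlas A) (differential_along (tangent_atlas A) vertical_endo E)"

definition finsler_manifold :: "'a topology \<Rightarrow> ('a, 'e::euclidean_space) chart set \<Rightarrow>
    ('a \<times> ('a, 'e) tvec \<Rightarrow> real) \<Rightarrow> bool" where
  "finsler_manifold M A E \<longleftrightarrow>
     smooth_manifold M A \<and> connected_space M \<and>
     (\<forall>p\<in>topspace M. E (p, \<lambda>_. 0) = 0) \<and>
     (\<forall>z\<in>slit_bundle A. 0 < E z) \<and>
     manifold_Ck_on (tangent_atlas A) 1 (tangent_bundle A) E \<and>
     manifold_smooth_on (tangent_atlas A) (slit_bundle A) E \<and>
     (\<forall>z\<in>tangent_bundle A. differential (tangent_atlas A) E z (liouville A z) = 2 * E z) \<and>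
     (\<forall>z\<in>slit_bundle A. nondegenerate_at (tangent_atlas A) (fundamental_form A E) z)"

definition canonical_spray :: "('a, 'e::euclidean_space) chart set \<Rightarrow>
    ('a \<times> ('a, 'e) tvec \<Rightarrow> real) \<Rightarrow>
    'a \<times> ('a, 'e) tvec \<Rightarrow> ('a \<times> ('a, 'e) tvec, 'e \<times> 'e) tvec" where
  "canonical_spray A E z = (if z \<in> slit_bundle A
     then (\<lambda>c. - sharp (tangent_atlas A) (fundamental_form A E)
                    (differential (tangent_atlas A) E) z c)
     else (\<lambda>_. 0))"

text \<open>The spray \<open>S\<^sub>0 + 2 V + 2 (d\<^bsub>[J, V]\<^esub> E)\<^sup>#\<close>, to be used away from the zero section.\<close>

definition deformed_spray :: "('a, 'e::euclidean_space) chart set \<Rightarrow>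
    ('a \<times> ('a, 'e) tvec \<Rightarrow> real) \<Rightarrow>
    ('a \<times> ('a, 'e) tvec \<Rightarrow> ('a \<times> ('a, 'e) tvec, 'e \<times> 'e) tvec) \<Rightarrow>
    'a \<times> ('a, 'e) tvec \<Rightarrow> ('a \<times> ('a, 'e) tvec, 'e \<times> 'e) tvec" where
  "deformed_spray A E V z = (\<lambda>c. canonical_spray A E z c + 2 *\<^sub>R V z c
     + 2 *\<^sub>R sharp (tangent_atlas A) (fundamental_form A E)
              (differential_along (tangent_atlas A)
                 (vector_form_bracket (tangent_atlas A) vertical_endo V) E) z c)"

definition projectively_related :: "('a, 'e::euclidean_space) chart set \<Rightarrow>
    ('a \<times> ('a, 'e) tvec \<Rightarrow> ('a \<times> ('a, 'e) tvec, 'e \<times> 'e) tvec) \<Rightarrow>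
    ('a \<times> ('a, 'e) tvec \<Rightarrow> ('a \<times> ('a, 'e) tvec, 'e \<times> 'e) tvec) \<Rightarrow>
    ('a \<times> ('a, 'e) tvec \<Rightarrow> real) \<Rightarrow> bool" where
  "projectively_related A S S' lam \<longleftrightarrow>
     manifold_smooth_on (tangent_atlas A) (slit_bundle A) lam \<and>
     (\<forall>z\<in>slit_bundle A. S z = (\<lambda>c. S' z c + lam z *\<^sub>R liouville A z c))"

end

theory Submission
  imports Defs
begin

text \<open>
  Let \<open>\<omega> = d d\<^sub>J E\<close>. Subtracting the two sprays removes the canonical spray and leaves
  \<open>2 W + 2 (d\<^bsub>[J, W]\<^esub> E)\<^sup># = \<lambda> C\<close> with \<open>W = V - U\<close>. Both sides are inserted in the first slot of
  \<open>\<omega>\<close>, and a vector \<open>w\<close> with \<open>J w = C\<close> in the second. Three values are needed.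

  \<^item> In induced coordinates \<open>(x, y)\<close> one has \<open>\<omega>((0, b), w) = E\<^sub>y\<^sub>y(b, y)\<close>. Since \<open>E\<close> is homogeneous of
    degree 2, its derivative \<open>E\<^sub>y\<close> is homogeneous of degree 1, so that this equals \<open>E\<^sub>y(b)\<close>. Hence
    \<open>\<omega>(Z, w) = Z E\<close> for every vertical \<open>Z\<close> (\<open>fundamental_form_vertical\<close>), in particular for \<open>W\<close>.

  \<^item> For \<open>Z = C\<close> the same formula gives \<open>\<omega>(C, w) = C E = 2 E\<close>.

  \<^item> By the definition of \<open>#\<close>, the remaining term is \<open>([J, W] w) E\<close>. In coordinates \<open>[J, W]\<close> is
    \<open>(a, b) \<mapsto> (0, W\<^sub>y a)\<close>. Applied to \<open>w\<close> it differentiates \<open>W\<close> in the direction \<open>y\<close>, which by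
    \<open>[C, W] = W\<close> gives \<open>2 W\<close>. The term is therefore \<open>2 W E\<close>
    (\<open>fundamental_form_sharp_bracket\<close>).

  Altogether \<open>2 W E + 4 W E = 2 \<lambda> E\<close>, and \<open>E\<close> is positive off the zero section.

  The argument is local, and all of it takes place in the chart that \<open>chart_at\<close> selects at the
  point in question. Passing to this chart requires the change-of-chart rules on the tangent
  bundle: near the point \<open>d\<^sub>J E\<close> is evaluated in the charts selected at the neighbouring points, which may
  be different ones. These rules rest on the transition maps \<open>(x, y) \<mapsto> (\<phi> x, D\<phi>(x) y)\<close> being
  differentiable, with derivatives that commute with \<open>(a, b) \<mapsto> (0, a)\<close>.
\<close>

section \<open>Calculus in coordinates\<close>

text \<open>The two sides are choices from the same set of derivatives, which may be empty.\<close>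

lemma frechet_derivative_cong_open:
  assumes "open S" "x \<in> S" "\<And>y. y \<in> S \<Longrightarrow> f y = g y"
  shows "frechet_derivative f (at x) = frechet_derivative g (at x)"
proof -
  have "(f has_derivative D) (at x) \<longleftrightarrow> (g has_derivative D) (at x)" for D
    using has_derivative_transform_within_open[of f D x UNIV S g]
      has_derivative_transform_within_open[of g D x UNIV S f] assms by auto
  then show ?thesis by (simp add: frechet_derivative_def)
qed

lemma Ck_on_2_differentiable:
  assumes "Ck_on 2 S f" "x \<in> S"
  shows "f differentiable (at x)"
    and "(\<lambda>x. frechet_derivative f (at x) v) differentiable (at x)"
  using assms by (simp_all add: numeral_2_eq_2)

lemma has_derivative_compose_fst:
  assumes "(f has_derivative f') (at (fst z))"
  shows "((\<lambda>z. f (fst z)) has_derivative (\<lambda>h. f' (fst h))) (at z)"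
  by (rule has_derivative_compose[OF has_derivative_fst[OF has_derivative_ident] assms])

lemma linear_frechet_derivative_sum:
  fixes f :: "'a::euclidean_space \<Rightarrow> 'b::real_normed_vector" and L :: "'c::euclidean_space \<Rightarrow> 'a"
  assumes "f differentiable (at x)" "linear L"
  shows "frechet_derivative f (at x) (L y) = (\<Sum>b\<in>Basis. (y \<bullet> b) *\<^sub>R frechet_derivative f (at x) (L b))"
proof -
  have lin: "linear (\<lambda>y. frechet_derivative f (at x) (L y))"
    using linear_compose[OF assms(2) linear_frechet_derivative[OF assms(1)]]
    by (simp add: o_def)
  have "frechet_derivative f (at x) (L (\<Sum>b\<in>Basis. (y \<bullet> b) *\<^sub>R b))
      = (\<Sum>b\<in>Basis. (y \<bullet> b) *\<^sub>R frechet_derivative f (at x) (L b))"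
    by (simp add: linear_sum[OF lin] linear_cmul[OF lin])
  then show ?thesis by (simp add: euclidean_representation)
qed

text \<open>A product rule for \<open>x \<mapsto> Df(u x)(L (g x))\<close>, in which the base point and the direction
  vary together. Each directional derivative being differentiable suffices, because \<open>L (g x)\<close> can
  be expanded in a basis. The map \<open>u\<close> is the identity for energy functions and the bundle
  projection for transition maps, \<open>L\<close> the inclusion of the fibre directions or the identity.\<close>

lemma has_derivative_frechet_derivative_apply:
  fixes f :: "'a::euclidean_space \<Rightarrow> 'b::real_normed_vector" and L :: "'c::euclidean_space \<Rightarrow> 'a"
    and u :: "'d::euclidean_space \<Rightarrow> 'a" and g :: "'d \<Rightarrow> 'c"
  assumes S: "open S" "x \<in> S" and f: "\<And>x. x \<in> S \<Longrightarrow> f differentiable (at (u x))"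
    and L: "linear L"
    and Df: "\<And>v. (\<lambda>x. frechet_derivative f (at (u x)) v) differentiable (at x)"
    and g: "(g has_derivative g') (at x)"
  shows "((\<lambda>x. frechet_derivative f (at (u x)) (L (g x))) has_derivative
    (\<lambda>h. frechet_derivative (\<lambda>x'. frechet_derivative f (at (u x')) (L (g x))) (at x) h
       + frechet_derivative f (at (u x)) (L (g' h)))) (at x)"
proof -
  define D where "D b = frechet_derivative (\<lambda>x. frechet_derivative f (at (u x)) (L b)) (at x)" for b
  have D: "((\<lambda>x. frechet_derivative f (at (u x)) (L b)) has_derivative D b) (at x)" for b
    using Df frechet_derivative_works unfolding D_def by blast
  have expand: "(\<Sum>b\<in>Basis. (y \<bullet> b) *\<^sub>R frechet_derivative f (at (u x)) (L b))
      = frechet_derivative f (at (u x)) (L y)" if "x \<in> S" for x y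
    by (rule linear_frechet_derivative_sum[OF f[OF that] L, symmetric])
  have "((\<lambda>x'. \<Sum>b\<in>Basis. (g x \<bullet> b) *\<^sub>R frechet_derivative f (at (u x')) (L b)) has_derivative
     (\<lambda>h. \<Sum>b\<in>Basis. (g x \<bullet> b) *\<^sub>R D b h)) (at x)"
    by (intro derivative_intros D)
  then have "((\<lambda>x'. frechet_derivative f (at (u x')) (L (g x))) has_derivative
     (\<lambda>h. \<Sum>b\<in>Basis. (g x \<bullet> b) *\<^sub>R D b h)) (at x)"
    by (rule has_derivative_transform_within_open[OF _ S expand])
  then have Dg: "D (g x) = (\<lambda>h. \<Sum>b\<in>Basis. (g x \<bullet> b) *\<^sub>R D b h)"
    by (rule has_derivative_unique[OF D])
  have "((\<lambda>x'. \<Sum>b\<in>Basis. (g x' \<bullet> b) *\<^sub>R frechet_derivative f (at (u x')) (L b)) has_derivative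
     (\<lambda>h. \<Sum>b\<in>Basis. (g x \<bullet> b) *\<^sub>R D b h + (g' h \<bullet> b) *\<^sub>R frechet_derivative f (at (u x)) (L b))) (at x)"
    by (intro has_derivative_sum has_derivative_scaleR has_derivative_inner_left g D)
  then have "((\<lambda>x. frechet_derivative f (at (u x)) (L (g x))) has_derivative
     (\<lambda>h. \<Sum>b\<in>Basis. (g x \<bullet> b) *\<^sub>R D b h + (g' h \<bullet> b) *\<^sub>R frechet_derivative f (at (u x)) (L b))) (at x)"
    by (rule has_derivative_transform_within_open[OF _ S expand])
  then show ?thesis
    unfolding sum.distrib expand[OF S(2)] D_def[symmetric] Dg .
qed

section \<open>Atlases with differentiable transition maps\<close>

text \<open>Openness is expressed in the model space, so that the notion applies to the tangent bundle,
  which is given by its charts alone.\<close>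

definition differentiable_atlas :: "('a, 'e::euclidean_space) chart set \<Rightarrow> bool" where
  "differentiable_atlas A \<longleftrightarrow>
     (\<forall>c\<in>A. inj_on (snd c) (fst c)) \<and>
     (\<forall>c\<in>A. \<forall>d\<in>A. open (snd c ` (fst c \<inter> fst d)) \<and>
        (\<forall>p\<in>fst c \<inter> fst d. in_chart c (snd d) differentiable (at (snd c p))))"

lemma in_chart_apply:
  assumes "differentiable_atlas A" "c \<in> A" "p \<in> fst c"
  shows "in_chart c f (snd c p) = f p"
  using assms by (simp add: differentiable_atlas_def in_chart_def)

lemma
  assumes "differentiable_atlas A" "c \<in> A" "d \<in> A"
  shows open_overlap: "open (snd c ` (fst c \<inter> fst d))"
    and transition_differentiable:
      "p \<in> fst c \<Longrightarrow> p \<in> fst d \<Longrightarrow> in_chart c (snd d) differentiable (at (snd c p))"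
  using assms by (simp_all add: differentiable_atlas_def)

lemma open_chart_image:
  assumes "differentiable_atlas A" "c \<in> A"
  shows "open (snd c ` fst c)"
  using open_overlap[OF assms assms(2)] by simp

lemma frechet_derivative_in_chart_self:
  assumes "differentiable_atlas A" "c \<in> A" "p \<in> fst c"
  shows "frechet_derivative (in_chart c (snd c)) (at (snd c p)) w = w"
proof -
  have "frechet_derivative (in_chart c (snd c)) (at (snd c p)) = frechet_derivative (\<lambda>x. x) (at (snd c p))"
    by (rule frechet_derivative_cong_open[OF open_chart_image[OF assms(1,2)]])
      (use assms in_chart_apply[OF assms(1,2)] in auto)
  then show ?thesis by (simp add: frechet_derivative_ident)
qed

text \<open>The chain rule for a change of chart. It yields the cocycle identity of the transition
  derivatives (taking a third coordinate map for \<open>f\<close>), hence tangent vectors with prescribed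
  components, and the independence of \<open>differential\<close> from the chart.\<close>

lemma in_chart_change:
  assumes A: "differentiable_atlas A" "c \<in> A" "d \<in> A" and p: "p \<in> fst c \<inter> fst d"
    and f: "in_chart d f differentiable (at (snd d p))"
  shows "frechet_derivative (in_chart c f) (at (snd c p)) w
       = frechet_derivative (in_chart d f) (at (snd d p))
           (frechet_derivative (in_chart c (snd d)) (at (snd c p)) w)" (is "_ = ?r w")
proof -
  have S: "open (snd c ` (fst c \<inter> fst d))" and t: "in_chart c (snd d) differentiable (at (snd c p))"
    using open_overlap[OF A] transition_differentiable[OF A] p by auto
  have "in_chart d f differentiable (at (in_chart c (snd d) (snd c p)))"
    using f p by (simp add: in_chart_apply[OF A(1,2)])
  then have "((in_chart d f \<circ> in_chart c (snd d)) has_derivative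
      (frechet_derivative (in_chart d f) (at (in_chart c (snd d) (snd c p))) \<circ>
       frechet_derivative (in_chart c (snd d)) (at (snd c p)))) (at (snd c p))"
    using t by (intro diff_chain_at) (simp_all flip: frechet_derivative_works)
  then have "(in_chart c f has_derivative
      (frechet_derivative (in_chart d f) (at (in_chart c (snd d) (snd c p))) \<circ>
       frechet_derivative (in_chart c (snd d)) (at (snd c p)))) (at (snd c p))"
    by (rule has_derivative_transform_within_open[OF _ S])
      (use p in \<open>auto simp: in_chart_apply[OF A(1,2)] in_chart_apply[OF A(1,3)]\<close>)
  then have "frechet_derivative (in_chart c f) (at (snd c p)) =
      (frechet_derivative (in_chart d f) (at (in_chart c (snd d) (snd c p))) \<circ>
       frechet_derivative (in_chart c (snd d)) (at (snd c p)))"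
    by (rule frechet_derivative_at[symmetric])
  then show ?thesis using p by (simp add: in_chart_apply[OF A(1,2)])
qed

lemma coord_field_self:
  assumes "differentiable_atlas A" "c \<in> A" "p \<in> fst c"
  shows "coord_field A c w p c = w"
  using assms by (simp add: coord_field_def frechet_derivative_in_chart_self)

lemma coord_field_in_tangent_space:
  assumes A: "differentiable_atlas A" "c \<in> A" "p \<in> fst c"
  shows "coord_field A c w p \<in> tangent_space A p"
  unfolding tangent_space_def mem_Collect_eq
proof (intro conjI ballI allI impI)
  fix d e assume "d \<in> A" "e \<in> A" and p: "p \<in> fst d \<inter> fst e"
  then have "frechet_derivative (in_chart c (snd e)) (at (snd c p)) w
      = frechet_derivative (in_chart d (snd e)) (at (snd d p))
          (frechet_derivative (in_chart c (snd d)) (at (snd c p)) w)"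
    using in_chart_change[OF A(1,2) _ _ transition_differentiable[OF A(1)]] A(3) by blast
  then show "coord_field A c w p e
      = frechet_derivative (in_chart d (snd e)) (at (snd d p)) (coord_field A c w p d)"
    unfolding coord_field_def using \<open>d \<in> A\<close> \<open>e \<in> A\<close> p by (simp only: Int_iff simp_thms if_True)
qed (auto simp: coord_field_def)

lemma tangent_vector_transform:
  assumes "v \<in> tangent_space A p" "c \<in> A" "d \<in> A" "p \<in> fst c" "p \<in> fst d"
  shows "v d = frechet_derivative (in_chart c (snd d)) (at (snd c p)) (v c)"
  using assms unfolding tangent_space_def by blast

lemma tangent_vector_eqI:
  assumes "v \<in> tangent_space A p" "w \<in> tangent_space A p" "c \<in> A" "p \<in> fst c" "v c = w c"
  shows "v = w"
proof
  fix d show "v d = w d"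
  proof (cases "d \<in> A \<and> p \<in> fst d")
    case True
    then show ?thesis
      using tangent_vector_transform[OF assms(1,3) _ assms(4)]
        tangent_vector_transform[OF assms(2,3) _ assms(4)] assms(5) by metis
  next
    case False
    then have "v d = 0" "w d = 0" using assms(1,2) unfolding tangent_space_def by blast+
    then show ?thesis by simp
  qed
qed

lemma chart_at:
  assumes "c \<in> A" "p \<in> fst c"
  shows "chart_at A p \<in> A" "p \<in> fst (chart_at A p)"
  using someI[of "\<lambda>c. c \<in> A \<and> p \<in> fst c" c] assms by (auto simp: chart_at_def)

lemma differential_in_chart:
  assumes A: "differentiable_atlas A" "c \<in> A" "p \<in> fst c"
    and v: "v \<in> tangent_space A p" and f: "in_chart c f differentiable (at (snd c p))"
  shows "differential A f p v = frechet_derivative (in_chart c f) (at (snd c p)) (v c)"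
proof -
  note ch = chart_at[OF A(2,3)]
  have "v c = frechet_derivative (in_chart (chart_at A p) (snd c)) (at (snd (chart_at A p) p)) (v (chart_at A p))"
    by (rule tangent_vector_transform[OF v ch(1) A(2) ch(2) A(3)])
  then show ?thesis
    unfolding differential_def Let_def by (simp only: in_chart_change[OF A(1) ch(1) A(2) IntI[OF ch(2) A(3)] f])
qed

text \<open>Via the inner product, the form \<open>H\<close> in coordinates becomes an endomorphism \<open>g\<close> of the model
  space. Nondegeneracy says that \<open>g\<close> is injective, hence it is surjective by finite dimension:
  this is what makes the definite description in \<open>sharp\<close> meaningful.\<close>

lemma sharp_works:
  assumes A: "differentiable_atlas A" "c \<in> A" "p \<in> fst c"
    and nd: "nondegenerate_at A \<omega> p"
    and H: "bilinear H" "\<And>v w. v \<in> tangent_space A p \<Longrightarrow> w \<in> tangent_space A p \<Longrightarrow> \<omega> p v w = H (v c) (w c)"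
    and L: "linear L" "\<And>w. w \<in> tangent_space A p \<Longrightarrow> \<beta> p w = L (w c)"
  shows "sharp A \<omega> \<beta> p \<in> tangent_space A p" "H (sharp A \<omega> \<beta> p c) w = L w"
proof -
  note T = coord_field_in_tangent_space[OF A] and self = coord_field_self[OF A]
  have H1: "linear (H u)" and H2: "linear (\<lambda>u. H u w)" for u w
    using H(1) by (auto simp: bilinear_def)
  have inj0: "u = 0" if "\<And>w. H u w = 0" for u
  proof -
    have "coord_field A c u p = (\<lambda>_. 0)"
      using nd T H(2) that by (simp add: nondegenerate_at_def self)
    then show ?thesis using self[of u] by simp
  qed
  define g where "g u = (\<Sum>b\<in>Basis. H u b *\<^sub>R b)" for u
  have ginner: "g u \<bullet> w = H u w" for u w
  proof -
    have "H u w = H u (\<Sum>b\<in>Basis. (w \<bullet> b) *\<^sub>R b)" by (simp add: euclidean_representation)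
    also have "\<dots> = (\<Sum>b\<in>Basis. (w \<bullet> b) * H u b)"
      by (simp add: linear_sum[OF H1] linear_cmul[OF H1])
    finally show ?thesis
      unfolding g_def inner_sum_left by (simp add: inner_commute mult.commute)
  qed
  have "linear g"
    by (rule linearI) (auto simp: g_def linear_add[OF H2] linear_cmul[OF H2] scaleR_left_distrib
        sum.distrib scaleR_sum_right)
  moreover have "inj g"
    unfolding linear_injective_0[OF \<open>linear g\<close>] using inj0 ginner by (metis inner_zero_left)
  ultimately have "surj g" by (simp add: linear_injective_imp_surjective)
  then obtain u where u: "g u = (\<Sum>b\<in>Basis. L b *\<^sub>R b)" by (metis surjD)
  have HuL: "H u w = L w" for w
  proof -
    have "L w = L (\<Sum>b\<in>Basis. (w \<bullet> b) *\<^sub>R b)" by (simp add: euclidean_representation)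
    also have "\<dots> = (\<Sum>b\<in>Basis. (w \<bullet> b) * L b)"
      by (simp add: linear_sum[OF L(1)] linear_cmul[OF L(1)])
    finally show ?thesis
      unfolding ginner[symmetric] u inner_sum_left by (simp add: inner_commute mult.commute)
  qed
  have "sharp A \<omega> \<beta> p = coord_field A c u p"
    unfolding sharp_def
  proof (rule the_equality)
    show "coord_field A c u p \<in> tangent_space A p \<and> (\<forall>w\<in>tangent_space A p. \<omega> p (coord_field A c u p) w = \<beta> p w)"
      using T H(2) L(2) HuL by (simp add: self)
  next
    fix v assume v: "v \<in> tangent_space A p \<and> (\<forall>w\<in>tangent_space A p. \<omega> p v w = \<beta> p w)"
    have "H (v c) w = L w" for w
      using v T[of w] H(2)[of v "coord_field A c w p"] L(2)[of "coord_field A c w p"]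
      by (simp add: self)
    then have "H (v c - u) w = 0" for w by (simp add: linear_diff[OF H2] HuL)
    then have "v c = u" using inj0[of "v c - u"] by simp
    then show "v = coord_field A c u p"
      using v T A self by (metis tangent_vector_eqI)
  qed
  then show "sharp A \<omega> \<beta> p \<in> tangent_space A p" "H (sharp A \<omega> \<beta> p c) w = L w"
    using T HuL by (auto simp: self)
qed

section \<open>The atlas of the tangent bundle\<close>

lemma smooth_manifold_transition_Ck:
  assumes "smooth_manifold M A" "c \<in> A" "d \<in> A"
  shows "Ck_on k (snd c ` (fst c \<inter> fst d)) (in_chart c (snd d))"
  using assms by (simp add: smooth_manifold_def smooth_on_def)

lemma smooth_manifold_imp_differentiable_atlas:
  assumes M: "smooth_manifold M A"
  shows "differentiable_atlas A"
proof -
  have op: "openin M (fst c)" "open (snd c ` fst c)" and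
    hom: "homeomorphic_map (subtopology M (fst c)) (top_of_set (snd c ` fst c)) (snd c)"
    if "c \<in> A" for c
    using M that by (auto simp: smooth_manifold_def)
  have "inj_on (snd c) (fst c)" if "c \<in> A" for c
    using homeomorphic_imp_injective_map[OF hom[OF that]] openin_subset[OF op(1)[OF that]]
    by (simp add: topspace_subtopology inf.absorb2)
  moreover have "open (snd c ` (fst c \<inter> fst d))" if "c \<in> A" "d \<in> A" for c d
  proof -
    have "openin (subtopology M (fst c)) (fst c \<inter> fst d)"
      using op(1)[OF that(2)] by (simp add: openin_subtopology_Int2)
    then have "openin (top_of_set (snd c ` fst c)) (snd c ` (fst c \<inter> fst d))"
      using homeomorphic_imp_open_map[OF hom[OF that(1)]] by (simp add: open_map_def)
    then show ?thesis using op(2)[OF that(1)] openin_open_eq by blast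
  qed
  moreover have "in_chart c (snd d) differentiable (at (snd c p))"
    if "c \<in> A" "d \<in> A" "p \<in> fst c \<inter> fst d" for c d p
    using Ck_on_2_differentiable(1)[OF smooth_manifold_transition_Ck[OF M that(1,2)]] that(3) by blast
  ultimately show ?thesis by (simp add: differentiable_atlas_def)
qed

lemma snd_tangent_chart [simp]: "snd (tangent_chart A c) z = (snd c (fst z), snd z c)"
  by (simp add: tangent_chart_def)

lemma fst_tangent_chart: "z \<in> fst (tangent_chart A c) \<longleftrightarrow> z \<in> tangent_bundle A \<and> fst z \<in> fst c"
  by (simp add: tangent_chart_def)

lemma tangent_bundle_iff:
  assumes "c \<in> A" "p \<in> fst c"
  shows "(p, v) \<in> tangent_bundle A \<longleftrightarrow> v \<in> tangent_space A p"
  using assms by (auto simp: tangent_bundle_def)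

text \<open>Every fibre coordinate \<open>y\<close> is attained, since each vector of the model space is the component
  of a tangent vector at each point of the chart.\<close>

lemma tangent_chart_image:
  assumes A: "differentiable_atlas A" "c \<in> A"
  shows "snd (tangent_chart A c) ` (fst (tangent_chart A c) \<inter> fst (tangent_chart A d))
       = (snd c ` (fst c \<inter> fst d)) \<times> UNIV" (is "?l = ?r")
proof
  show "?l \<subseteq> ?r" by (auto simp: fst_tangent_chart)
next
  show "?r \<subseteq> ?l"
  proof clarify
    fix p y assume p: "p \<in> fst c" "p \<in> fst d"
    let ?z = "(p, coord_field A c y p)"
    have "?z \<in> fst (tangent_chart A c) \<inter> fst (tangent_chart A d)"
      using p A coord_field_in_tangent_space[OF A p(1)] by (simp add: fst_tangent_chart tangent_bundle_iff)
    moreover have "(snd c p, y) = snd (tangent_chart A c) ?z"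
      using coord_field_self[OF A p(1)] by simp
    ultimately show "(snd c p, y) \<in> ?l" by blast
  qed
qed

lemma slit_chart_image:
  assumes A: "differentiable_atlas A" "c \<in> A"
  shows "snd (tangent_chart A c) ` (fst (tangent_chart A c) \<inter> slit_bundle A)
       = (snd c ` fst c) \<times> (- {0})" (is "?l = ?r")
proof
  have "v = (\<lambda>_. 0)" if "v \<in> tangent_space A p" "p \<in> fst c" "v c = 0" for p v
  proof (rule tangent_vector_eqI[OF that(1) _ A(2) that(2)])
    have "linear (frechet_derivative (in_chart e (snd d)) (at (snd e p)))"
      if "e \<in> A" "d \<in> A" "p \<in> fst e \<inter> fst d" for e d
      using transition_differentiable[OF A(1) that(1,2)] that(3) by (simp add: linear_frechet_derivative)
    then show "(\<lambda>_. 0) \<in> tangent_space A p" unfolding tangent_space_def using linear_0 by fastforce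
  qed (use that in simp)
  then show "?l \<subseteq> ?r" by (force simp: fst_tangent_chart slit_bundle_def tangent_bundle_def)
next
  show "?r \<subseteq> ?l"
  proof
    fix x assume "x \<in> ?r"
    then obtain p y where x: "x = (snd c p, y)" and p: "p \<in> fst c" and y: "y \<noteq> 0" by auto
    let ?z = "(p, coord_field A c y p)"
    note self = coord_field_self[OF A p]
    have "coord_field A c y p \<noteq> (\<lambda>_. 0)" using self[of y] y by auto
    then have "?z \<in> fst (tangent_chart A c) \<inter> slit_bundle A"
      using p A coord_field_in_tangent_space[OF A p]
      by (simp add: fst_tangent_chart tangent_bundle_iff slit_bundle_def)
    moreover have "x = snd (tangent_chart A c) ?z"
      using self x by simp
    ultimately show "x \<in> ?l" by blast
  qed
qed

lemma inj_on_tangent_chart: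
  assumes A: "differentiable_atlas A" "c \<in> A"
  shows "inj_on (snd (tangent_chart A c)) (fst (tangent_chart A c))"
proof (rule inj_onI)
  fix z z' assume z: "z \<in> fst (tangent_chart A c)" "z' \<in> fst (tangent_chart A c)"
    and eq: "snd (tangent_chart A c) z = snd (tangent_chart A c) z'"
  have "fst z = fst z'"
    using z eq A inj_onD[of "snd c" "fst c" "fst z" "fst z'"]
    by (auto simp: fst_tangent_chart differentiable_atlas_def)
  moreover have "snd z = snd z'"
    using z eq A calculation by (intro tangent_vector_eqI[of _ A "fst z" _ c])
      (auto simp: fst_tangent_chart tangent_bundle_def)
  ultimately show "z = z'" by (simp add: prod_eq_iff)
qed

text \<open>On the tangent bundle the transition map is \<open>(x, y) \<mapsto> (\<phi> x, D\<phi>(x) y)\<close>; its second component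
  is differentiated by the product rule.\<close>

lemma tangent_transition_has_derivative:
  assumes M: "smooth_manifold M A" and c: "c \<in> A" "d \<in> A" and p: "p \<in> fst c \<inter> fst d"
  defines "\<phi> \<equiv> in_chart c (snd d)"
  shows "(in_chart (tangent_chart A c) (snd (tangent_chart A d)) has_derivative
      (\<lambda>h. (frechet_derivative \<phi> (at (snd c p)) (fst h),
           frechet_derivative (\<lambda>x. frechet_derivative \<phi> (at (fst x)) y) (at (snd c p, y)) h
           + frechet_derivative \<phi> (at (snd c p)) (snd h)))) (at (snd c p, y))"
proof -
  note A = smooth_manifold_imp_differentiable_atlas[OF M]
  let ?S = "(snd c ` (fst c \<inter> fst d)) \<times> (UNIV :: 'b set)"
  have S: "open ?S" "(snd c p, y) \<in> ?S"
    using open_overlap[OF A c] p by (auto intro!: open_Times)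
  have \<phi>: "\<phi> differentiable (at (fst x))" "(\<lambda>x. frechet_derivative \<phi> (at x) v) differentiable (at (fst x))"
    if "x \<in> ?S" for x v
    using Ck_on_2_differentiable[OF smooth_manifold_transition_Ck[OF M c]] that
    by (auto simp: \<phi>_def)
  have 1: "((\<lambda>x. \<phi> (fst x)) has_derivative (\<lambda>h. frechet_derivative \<phi> (at (snd c p)) (fst h)))
      (at (snd c p, y))"
    by (rule has_derivative_compose_fst) (use \<phi>(1)[OF S(2)] in \<open>simp add: frechet_derivative_works\<close>)
  have D\<phi>: "(\<lambda>x. frechet_derivative \<phi> (at (fst x)) v) differentiable (at (snd c p, y))" for v
    using \<phi>(2)[OF S(2), of v] has_derivative_compose_fst unfolding differentiable_def by blast
  have 2: "((\<lambda>x. frechet_derivative \<phi> (at (fst x)) (id (snd x))) has_derivative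
    (\<lambda>h. frechet_derivative (\<lambda>x'. frechet_derivative \<phi> (at (fst x')) (id (snd (snd c p, y)))) (at (snd c p, y)) h
       + frechet_derivative \<phi> (at (fst (snd c p, y))) (id (snd h)))) (at (snd c p, y))"
    by (rule has_derivative_frechet_derivative_apply
          [where f = \<phi> and u = fst and L = id and g = snd and g' = snd,
            OF S \<phi>(1) linear_id D\<phi> has_derivative_snd[OF has_derivative_ident]])
  have eq: "(\<phi> (fst x), frechet_derivative \<phi> (at (fst x)) (snd x))
      = in_chart (tangent_chart A c) (snd (tangent_chart A d)) x" if "x \<in> ?S" for x
  proof -
    have "x \<in> snd (tangent_chart A c) ` (fst (tangent_chart A c) \<inter> fst (tangent_chart A d))"
      using that unfolding tangent_chart_image[OF A c(1)] .
    then obtain z where z: "z \<in> fst (tangent_chart A c)" "z \<in> fst (tangent_chart A d)"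
      and x: "x = snd (tangent_chart A c) z" by blast
    have "in_chart (tangent_chart A c) (snd (tangent_chart A d)) x = snd (tangent_chart A d) z"
      using inj_on_tangent_chart[OF A c(1)] z by (simp only: in_chart_def x o_apply inv_into_f_f)
    moreover have "snd z d = frechet_derivative \<phi> (at (snd c (fst z))) (snd z c)"
      unfolding \<phi>_def using z
      by (intro tangent_vector_transform[OF _ c]) (auto simp: fst_tangent_chart tangent_bundle_def)
    ultimately show ?thesis
      using x z by (simp add: \<phi>_def fst_tangent_chart in_chart_apply[OF A c(1)])
  qed
  show ?thesis
    by (rule has_derivative_transform_within_open[OF _ S eq])
      (use has_derivative_Pair[OF 1 2] in simp_all)
qed

lemma tangent_atlas_differentiable:
  assumes M: "smooth_manifold M A"
  shows "differentiable_atlas (tangent_atlas A)"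
proof -
  note A = smooth_manifold_imp_differentiable_atlas[OF M]
  have "open (snd c ` (fst c \<inter> fst d) \<times> (UNIV :: 'b set))" if "c \<in> A" "d \<in> A" for c d
    using open_overlap[OF A that] by (intro open_Times) simp_all
  moreover have "in_chart (tangent_chart A c) (snd (tangent_chart A d)) differentiable
      (at (snd (tangent_chart A c) z))"
    if "c \<in> A" "d \<in> A" "z \<in> fst (tangent_chart A c)" "z \<in> fst (tangent_chart A d)" for c d z
    using tangent_transition_has_derivative[OF M that(1,2), of "fst z" "snd z c"] that(3,4)
    by (auto simp: fst_tangent_chart differentiable_def)
  ultimately show ?thesis
    unfolding tangent_atlas_def differentiable_atlas_def[of "tangent_chart A ` A"]
    using inj_on_tangent_chart[OF A] tangent_chart_image[OF A] by simp
qed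

text \<open>The derivative of a transition map of the tangent bundle is block triangular with equal
  diagonal blocks. This is the reason why the Liouville field and the vertical endomorphism do not
  depend on the chart.\<close>

lemma
  assumes M: "smooth_manifold M A" and c: "c \<in> A" "d \<in> A"
    and z: "z \<in> fst (tangent_chart A c)" "z \<in> fst (tangent_chart A d)"
  defines "D \<equiv> frechet_derivative (in_chart (tangent_chart A c) (snd (tangent_chart A d)))
      (at (snd (tangent_chart A c) z))"
  shows tangent_transition_vertical:
      "D (0, e) = (0, frechet_derivative (in_chart c (snd d)) (at (snd c (fst z))) e)"
    and tangent_transition_fst:
      "fst (D h) = frechet_derivative (in_chart c (snd d)) (at (snd c (fst z))) (fst h)"
proof -
  note A = smooth_manifold_imp_differentiable_atlas[OF M]
  let ?\<phi> = "in_chart c (snd d)"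
  let ?x = "snd c (fst z)" and ?y = "snd z c"
  let ?G = "\<lambda>x. frechet_derivative ?\<phi> (at x) ?y"
  have p: "fst z \<in> fst c \<inter> fst d" using z by (simp add: fst_tangent_chart)
  have D: "D = (\<lambda>h. (frechet_derivative ?\<phi> (at ?x) (fst h),
           frechet_derivative (\<lambda>x. ?G (fst x)) (at (?x, ?y)) h
           + frechet_derivative ?\<phi> (at ?x) (snd h)))"
    using frechet_derivative_at[OF tangent_transition_has_derivative[OF M c p, of ?y]]
    unfolding D_def by simp
  show "fst (D h) = frechet_derivative ?\<phi> (at ?x) (fst h)" by (simp add: D)
  have lin: "linear (frechet_derivative ?\<phi> (at ?x))"
    using transition_differentiable[OF A c] p by (simp add: linear_frechet_derivative)
  have G: "?G differentiable (at ?x)"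
    using Ck_on_2_differentiable(2)[OF smooth_manifold_transition_Ck[OF M c]] p by blast
  have "((\<lambda>x. ?G (fst x)) has_derivative (\<lambda>h. frechet_derivative ?G (at ?x) (fst h))) (at (?x, ?y))"
    by (rule has_derivative_compose_fst) (use G in \<open>simp add: frechet_derivative_works\<close>)
  then have "frechet_derivative (\<lambda>x. ?G (fst x)) (at (?x, ?y)) (0, e) = 0"
    using linear_0[OF linear_frechet_derivative[OF G]]
    by (metis frechet_derivative_at fst_conv)
  then show "D (0, e) = (0, frechet_derivative ?\<phi> (at ?x) e)"
    using linear_0[OF lin] by (simp add: D)
qed


section \<open>The fundamental form in coordinates\<close>

text \<open>For the 1-form \<open>d\<^sub>J F = F\<^sub>y dx\<close> this is the 2-form \<open>d d\<^sub>J F\<close>, where \<open>(x, y)\<close> are the two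
  components of the argument of \<open>F\<close>.\<close>

definition coordinate_form :: "('e::euclidean_space \<times> 'e \<Rightarrow> real) \<Rightarrow> 'e \<times> 'e \<Rightarrow> 'e \<times> 'e \<Rightarrow> 'e \<times> 'e \<Rightarrow> real"
  where "coordinate_form F x v w =
    frechet_derivative (\<lambda>x. frechet_derivative F (at x) (0, fst w)) (at x) v -
    frechet_derivative (\<lambda>x. frechet_derivative F (at x) (0, fst v)) (at x) w"

lemma bilinear_second_derivative:
  fixes F :: "'a::euclidean_space \<Rightarrow> 'b::real_normed_vector" and L :: "'c::euclidean_space \<Rightarrow> 'a"
  assumes S: "open S" "x \<in> S" and F: "Ck_on 2 S F" and L: "linear L"
  shows "bilinear (\<lambda>e v. frechet_derivative (\<lambda>x. frechet_derivative F (at x) (L e)) (at x) v)"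
  unfolding bilinear_def
proof (intro conjI allI)
  note F' = Ck_on_2_differentiable[OF F]
  fix e
  show "linear (frechet_derivative (\<lambda>x. frechet_derivative F (at x) (L e)) (at x))"
    by (rule linear_frechet_derivative[OF F'(2)[OF S(2)]])
next
  note F' = Ck_on_2_differentiable[OF F]
  fix v
  have expand: "frechet_derivative (\<lambda>x. frechet_derivative F (at x) (L e)) (at x) h
     = (\<Sum>b\<in>Basis. (e \<bullet> b) *\<^sub>R frechet_derivative (\<lambda>x. frechet_derivative F (at x) (L b)) (at x) h)"
    for e h
  proof -
    have "((\<lambda>x. \<Sum>b\<in>Basis. (e \<bullet> b) *\<^sub>R frechet_derivative F (at x) (L b)) has_derivative
        (\<lambda>h. \<Sum>b\<in>Basis. (e \<bullet> b) *\<^sub>R frechet_derivative (\<lambda>x. frechet_derivative F (at x) (L b)) (at x) h)) (at x)"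
      by (intro has_derivative_sum has_derivative_scaleR_right)
        (use F'(2)[OF S(2)] in \<open>simp add: frechet_derivative_works\<close>)
    then have "((\<lambda>x. frechet_derivative F (at x) (L e)) has_derivative
        (\<lambda>h. \<Sum>b\<in>Basis. (e \<bullet> b) *\<^sub>R frechet_derivative (\<lambda>x. frechet_derivative F (at x) (L b)) (at x) h)) (at x)"
      by (rule has_derivative_transform_within_open[OF _ S])
        (rule linear_frechet_derivative_sum[OF F'(1) L, symmetric])
    from fun_cong[OF frechet_derivative_at[OF this], of h] show ?thesis by (rule sym)
  qed
  have "linear (\<lambda>e. \<Sum>b\<in>Basis. (e \<bullet> b) *\<^sub>R C b)" for C :: "'c \<Rightarrow> 'b"
    by (rule linearI) (simp_all add: inner_add_left scaleR_left_distrib sum.distrib scaleR_sum_right)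
  moreover have "(\<lambda>e. frechet_derivative (\<lambda>x. frechet_derivative F (at x) (L e)) (at x) v)
     = (\<lambda>e. \<Sum>b\<in>Basis. (e \<bullet> b) *\<^sub>R frechet_derivative (\<lambda>x. frechet_derivative F (at x) (L b)) (at x) v)"
    by (rule ext) (rule expand)
  ultimately show "linear (\<lambda>e. frechet_derivative (\<lambda>x. frechet_derivative F (at x) (L e)) (at x) v)"
    by (rule ssubst[where P = linear, rotated])
qed

lemma linear_Pair_0_left: "linear (\<lambda>e. (0, e))"
  by (rule linearI) simp_all

lemma bilinear_coordinate_form:
  assumes "open S" "x \<in> S" "Ck_on 2 S F"
  shows "bilinear (coordinate_form F x)"
proof -
  let ?B = "\<lambda>e v. frechet_derivative (\<lambda>x. frechet_derivative F (at x) (0, e)) (at x) v"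
  have B: "linear (?B e)" "linear (\<lambda>e. ?B e v)" for e v
    using bilinear_second_derivative[OF assms linear_Pair_0_left] unfolding bilinear_def by blast+
  have fst_B: "linear (\<lambda>w. ?B (fst w) v)" for v
    using linear_compose[OF linear_fst B(2)] by (simp only: o_def)
  have eq: "coordinate_form F x = (\<lambda>v w. ?B (fst w) v - ?B (fst v) w)"
    by (intro ext) (simp only: coordinate_form_def)
  have "linear (\<lambda>w. ?B (fst w) v - ?B (fst v) w)" for v
    by (rule linear_compose_sub[OF fst_B B(1)])
  moreover have "linear (\<lambda>v. ?B (fst w) v - ?B (fst v) w)" for w
    by (rule linear_compose_sub[OF B(1) fst_B])
  ultimately show ?thesis unfolding bilinear_def eq by blast
qed

text \<open>Differentiating Euler's relation \<open>F\<^sub>y(y) = 2 F\<close> in the direction \<open>(0, b)\<close> gives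
  \<open>F\<^sub>y\<^sub>y(b, y) + F\<^sub>y(b) = 2 F\<^sub>y(b)\<close>. The other term of the form vanishes, because \<open>(0, b)\<close> is vertical.\<close>

lemma coordinate_form_vertical:
  fixes F :: "'e::euclidean_space \<times> 'e \<Rightarrow> real"
  assumes S: "open S" "x \<in> S" and F: "Ck_on 2 S F"
    and hom: "\<And>x. x \<in> S \<Longrightarrow> frechet_derivative F (at x) (0, snd x) = 2 * F x"
    and w: "fst w = snd x"
  shows "coordinate_form F x (0, b) w = frechet_derivative F (at x) (0, b)"
proof -
  note F' = Ck_on_2_differentiable[OF F]
  have "((\<lambda>x. frechet_derivative F (at x) (0, snd x)) has_derivative
      (\<lambda>h. frechet_derivative (\<lambda>x'. frechet_derivative F (at x') (0, snd x)) (at x) h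
         + frechet_derivative F (at x) (0, snd h))) (at x)"
    by (rule has_derivative_frechet_derivative_apply
          [where f = F and u = "\<lambda>x. x" and L = "Pair 0" and g = snd and g' = snd,
            OF S F'(1) linear_Pair_0_left F'(2)[OF S(2)] has_derivative_snd[OF has_derivative_ident]])
  moreover have "((\<lambda>x. 2 * F x) has_derivative (\<lambda>h. 2 * frechet_derivative F (at x) h)) (at x)"
    using F'(1)[OF S(2)] by (intro has_derivative_mult_right) (simp add: frechet_derivative_works)
  then have "((\<lambda>x. frechet_derivative F (at x) (0, snd x)) has_derivative
      (\<lambda>h. 2 * frechet_derivative F (at x) h)) (at x)"
    by (rule has_derivative_transform_within_open[OF _ S]) (simp add: hom)
  ultimately have "(\<lambda>h. frechet_derivative (\<lambda>x'. frechet_derivative F (at x') (0, snd x)) (at x) h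
      + frechet_derivative F (at x) (0, snd h)) = (\<lambda>h. 2 * frechet_derivative F (at x) h)"
    by (rule has_derivative_unique)
  from fun_cong[OF this, of "(0, b)"]
  have "frechet_derivative (\<lambda>x'. frechet_derivative F (at x') (0, snd x)) (at x) (0, b)
      = frechet_derivative F (at x) (0, b)" by simp
  moreover have "frechet_derivative (\<lambda>x. frechet_derivative F (at x) (0, 0)) (at x) w = 0"
  proof -
    have "frechet_derivative (\<lambda>x. frechet_derivative F (at x) (0, 0)) (at x)
        = frechet_derivative (\<lambda>x. 0) (at x)"
      by (rule frechet_derivative_cong_open[OF S])
        (use linear_0[OF linear_frechet_derivative[OF F'(1)]] in \<open>simp add: zero_prod_def\<close>)
    then show ?thesis by simp
  qed
  ultimately show ?thesis by (simp add: coordinate_form_def w)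
qed

section \<open>Canonical objects in an induced chart\<close>

lemma vertical_vector_component: "vertical_vector v \<Longrightarrow> v k = (0, snd (v k))"
  by (simp add: vertical_vector_def prod_eq_iff del: split_paired_All)

lemma vertical_endo_in_tangent_space:
  assumes M: "smooth_manifold M A" and X: "X \<in> tangent_space (tangent_atlas A) z"
  shows "vertical_endo z X \<in> tangent_space (tangent_atlas A) z"
  unfolding tangent_space_def mem_Collect_eq
proof (intro conjI ballI allI impI)
  fix k l assume "k \<in> tangent_atlas A" "l \<in> tangent_atlas A" and z: "z \<in> fst k \<inter> fst l"
  then obtain c d where c: "c \<in> A" "d \<in> A" and kl: "k = tangent_chart A c" "l = tangent_chart A d"
    by (auto simp: tangent_atlas_def)
  have X_l: "X l = frechet_derivative (in_chart k (snd l)) (at (snd k z)) (X k)"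
    by (rule tangent_vector_transform[OF X]) (use z c kl in \<open>auto simp: tangent_atlas_def\<close>)
  have zc: "z \<in> fst (tangent_chart A c)" "z \<in> fst (tangent_chart A d)" using z kl by auto
  show "vertical_endo z X l = frechet_derivative (in_chart k (snd l)) (at (snd k z)) (vertical_endo z X k)"
    unfolding vertical_endo_def X_l unfolding kl
    by (simp only: tangent_transition_vertical[OF M c zc] tangent_transition_fst[OF M c zc])
qed (use X in \<open>auto simp: tangent_space_def vertical_endo_def zero_prod_def\<close>)

lemma liouville_in_tangent_space:
  assumes M: "smooth_manifold M A"
  shows "liouville A z \<in> tangent_space (tangent_atlas A) z"
  unfolding tangent_space_def mem_Collect_eq
proof (intro conjI ballI allI impI)
  fix k l assume kl_in: "k \<in> tangent_atlas A" "l \<in> tangent_atlas A" and z: "z \<in> fst k \<inter> fst l"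
  then obtain c d where c: "c \<in> A" "d \<in> A" and kl: "k = tangent_chart A c" "l = tangent_chart A d"
    by (auto simp: tangent_atlas_def)
  have zc: "z \<in> fst (tangent_chart A c)" "z \<in> fst (tangent_chart A d)" using z kl by auto
  have "snd z d = frechet_derivative (in_chart c (snd d)) (at (snd c (fst z))) (snd z c)"
    by (rule tangent_vector_transform[OF _ c]) (use zc in \<open>auto simp: fst_tangent_chart tangent_bundle_def\<close>)
  moreover have "liouville A z k = (0, snd z c)" "liouville A z l = (0, snd z d)"
    using kl_in z by (simp_all add: liouville_def kl)
  ultimately show "liouville A z l = frechet_derivative (in_chart k (snd l)) (at (snd k z)) (liouville A z k)"
    unfolding kl by (simp only: tangent_transition_vertical[OF M c zc])
qed (auto simp: liouville_def)

text \<open>The definition of \<open>d\<^sub>J E\<close> refers at each point \<open>q\<close> near \<open>z\<close> to the chart selected at \<open>q\<close>, not to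
  the one selected at \<open>z\<close>. Since \<open>J\<close> preserves tangent vectors, the value of \<open>d\<^sub>J E\<close> can be computed
  in the latter chart throughout a neighbourhood, which is what the outer derivative sees.\<close>

lemma fundamental_form_in_chart:
  assumes M: "smooth_manifold M A" and k: "k \<in> tangent_atlas A" "z \<in> fst k"
    and kz: "k = chart_at (tangent_atlas A) z"
    and S: "open S" "S \<subseteq> snd k ` fst k" "snd k z \<in> S" and E: "Ck_on 2 S (in_chart k E)"
  shows "fundamental_form A E z v w = coordinate_form (in_chart k E) (snd k z) (v k) (w k)"
proof -
  note T = tangent_atlas_differentiable[OF M]
  have *: "frechet_derivative (in_chart k (\<lambda>q. differential_along (tangent_atlas A) vertical_endo E q
          (coord_field (tangent_atlas A) k (w k) q))) (at (snd k z))
      = frechet_derivative (\<lambda>x. frechet_derivative (in_chart k E) (at x) (0, fst (w k))) (at (snd k z))" for w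
  proof (rule frechet_derivative_cong_open[OF S(1,3)])
    fix x assume "x \<in> S"
    then obtain q where q: "q \<in> fst k" "x = snd k q" using S(2) by auto
    let ?X = "coord_field (tangent_atlas A) k (w k) q"
    have "?X \<in> tangent_space (tangent_atlas A) q"
      by (rule coord_field_in_tangent_space[OF T k(1) q(1)])
    then have "vertical_endo q ?X \<in> tangent_space (tangent_atlas A) q"
      by (rule vertical_endo_in_tangent_space[OF M])
    moreover have "in_chart k E differentiable (at (snd k q))"
      using Ck_on_2_differentiable(1)[OF E] \<open>x \<in> S\<close> q by blast
    ultimately have "differential (tangent_atlas A) E q (vertical_endo q ?X)
        = frechet_derivative (in_chart k E) (at x) (vertical_endo q ?X k)"
      unfolding q(2) by (rule differential_in_chart[OF T k(1) q(1)])
    then show "in_chart k (\<lambda>q. differential_along (tangent_atlas A) vertical_endo E q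
          (coord_field (tangent_atlas A) k (w k) q)) x
        = frechet_derivative (in_chart k E) (at x) (0, fst (w k))"
      unfolding q(2)
      by (simp add: in_chart_apply[OF T k(1) q(1)] differential_along_def vertical_endo_def
          coord_field_self[OF T k(1) q(1)])
  qed
  show ?thesis
    unfolding fundamental_form_def ext_deriv_def local_extension_def differential_def Let_def
      kz[symmetric] coordinate_form_def by (simp add: *)
qed

text \<open>With \<open>X\<close> of constant components \<open>(a, b)\<close>, the field \<open>J X = (0, a)\<close> is constant too, so
  \<open>[J X, V] = DV(0, a)\<close>. The term \<open>J [X, V]\<close> vanishes, because \<open>[X, V] = DV(X)\<close> is vertical
  together with \<open>V\<close>.\<close>

lemma vertical_endo_bracket_in_chart:
  assumes M: "smooth_manifold M A" and k: "k \<in> tangent_atlas A" "z \<in> fst k"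
    and kz: "k = chart_at (tangent_atlas A) z"
    and S: "open S" "S \<subseteq> snd k ` fst k" "snd k z \<in> S"
    and V: "in_chart k (\<lambda>q. V q k) differentiable (at (snd k z))"
    and vert: "\<And>q. q \<in> fst k \<Longrightarrow> snd k q \<in> S \<Longrightarrow> fst (V q k) = 0"
  shows "vector_form_bracket (tangent_atlas A) vertical_endo V z w k
       = frechet_derivative (in_chart k (\<lambda>q. V q k)) (at (snd k z)) (0, fst (w k))"
proof -
  note T = tangent_atlas_differentiable[OF M]
  define D where "D = frechet_derivative (in_chart k (\<lambda>q. V q k)) (at (snd k z))"
  let ?X = "coord_field (tangent_atlas A) k (w k)"
  have X: "?X q k = w k" if "q \<in> fst k" for q by (rule coord_field_self[OF T k(1) that])
  have const: "frechet_derivative (in_chart k (\<lambda>q. g q)) (at (snd k z)) h = 0"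
    if "\<And>q. q \<in> fst k \<Longrightarrow> g q = g0" for g :: "_ \<Rightarrow> 'b \<times> 'b" and g0 h
  proof -
    have "frechet_derivative (in_chart k g) (at (snd k z)) = frechet_derivative (\<lambda>_. g0) (at (snd k z))"
      by (rule frechet_derivative_cong_open[OF S(1,3)])
        (use S(2) that in \<open>auto simp: in_chart_apply[OF T k(1)] dest!: subsetD\<close>)
    then show ?thesis by simp
  qed
  have fst_D: "fst (D h) = 0" for h
  proof -
    have "((\<lambda>x. fst (in_chart k (\<lambda>q. V q k) x)) has_derivative (\<lambda>h. fst (D h))) (at (snd k z))"
      using V unfolding D_def by (intro has_derivative_fst) (simp add: frechet_derivative_works)
    then have "((\<lambda>x. 0) has_derivative (\<lambda>h. fst (D h))) (at (snd k z))"
      by (rule has_derivative_transform_within_open[OF _ S(1,3)])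
        (use S(2) vert in \<open>auto simp: in_chart_apply[OF T k(1)] dest!: subsetD\<close>)
    from fun_cong[OF has_derivative_unique[OF this has_derivative_const], of h] show ?thesis by simp
  qed
  have "lie_bracket (tangent_atlas A) (\<lambda>q. vertical_endo q (?X q)) V z k = D (0, fst (w k))"
    using const[of "\<lambda>q. vertical_endo q (?X q) k"] k X by (simp add: lie_bracket_def D_def vertical_endo_def)
  moreover have "lie_bracket (tangent_atlas A) ?X V z k = D (w k)"
    using const[of "\<lambda>q. ?X q k"] k X by (simp add: lie_bracket_def D_def)
  ultimately show ?thesis
    unfolding vector_form_bracket_def local_extension_def kz[symmetric] Let_def D_def[symmetric]
    by (simp add: vertical_endo_def[of z "lie_bracket _ _ _ _"] fst_D zero_prod_def)
qed

text \<open>In coordinates \<open>[C, V] = DV(C) - DC(V)\<close>, and \<open>DC(V) = V\<close> for vertical \<open>V\<close>; so \<open>[C, V] = V\<close>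
  is Euler's relation of degree 2 for the components of \<open>V\<close>.\<close>

lemma homogeneous_field_2_in_chart:
  assumes M: "smooth_manifold M A" and k: "k \<in> tangent_atlas A" "z \<in> fst k" "z \<in> slit_bundle A"
    and V: "homogeneous_field_2 A V" "vertical_vector (V z)"
  shows "frechet_derivative (in_chart k (\<lambda>q. V q k)) (at (snd k z)) (0, snd (snd k z)) = 2 *\<^sub>R V z k"
proof -
  note T = tangent_atlas_differentiable[OF M]
  have "frechet_derivative (in_chart k (\<lambda>q. liouville A q k)) (at (snd k z)) h = (0, snd h)" for h
  proof -
    have "frechet_derivative (in_chart k (\<lambda>q. liouville A q k)) (at (snd k z))
        = frechet_derivative (\<lambda>x. (0, snd x)) (at (snd k z))"
      by (rule frechet_derivative_cong_open[OF open_chart_image[OF T k(1)]])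
        (use k in \<open>auto simp: in_chart_apply[OF T k(1)] liouville_def\<close>)
    moreover have "((\<lambda>x::'b \<times> 'b. (0::'b, snd x)) has_derivative (\<lambda>h. (0, snd h))) (at (snd k z))"
      by (auto intro!: derivative_eq_intros)
    ultimately show ?thesis by (simp add: frechet_derivative_at[symmetric])
  qed
  moreover have "V z k = (0, snd (V z k))"
    by (rule vertical_vector_component[OF V(2)])
  moreover have "lie_bracket (tangent_atlas A) (liouville A) V z k = V z k"
    using V(1) k(3) by (simp add: homogeneous_field_2_def)
  ultimately show ?thesis
    using k by (simp add: lie_bracket_def liouville_def algebra_simps scaleR_2)
qed


section \<open>The projective factor\<close>

text \<open>The zero section is removed from the chart domain, since \<open>E\<close> is in general only of class
  \<open>C\<^sup>1\<close> on it.\<close>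

lemma finsler_chart:
  assumes F: "finsler_manifold M A E" and z: "z \<in> slit_bundle A"
  defines "k \<equiv> chart_at (tangent_atlas A) z"
  defines "S \<equiv> snd k ` (fst k \<inter> slit_bundle A)"
  shows "k \<in> tangent_atlas A" "z \<in> fst k" "open S" "snd k z \<in> S" "S \<subseteq> snd k ` fst k"
    and "Ck_on 2 S (in_chart k E)"
    and "x \<in> S \<Longrightarrow> frechet_derivative (in_chart k E) (at x) (0, snd x) = 2 * in_chart k E x"
proof -
  have M: "smooth_manifold M A" using F by (simp add: finsler_manifold_def)
  note A = smooth_manifold_imp_differentiable_atlas[OF M] and T = tangent_atlas_differentiable[OF M]
  obtain c where c: "c \<in> A" "z \<in> fst (tangent_chart A c)"
    using z by (auto simp: slit_bundle_def tangent_bundle_def fst_tangent_chart)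
  then have tc: "tangent_chart A c \<in> tangent_atlas A" by (simp add: tangent_atlas_def)
  show k: "k \<in> tangent_atlas A" "z \<in> fst k"
    unfolding k_def using chart_at[OF tc c(2)] by auto
  then obtain d where d: "d \<in> A" "k = tangent_chart A d" by (auto simp: tangent_atlas_def)
  have "open (snd d ` fst d \<times> (- {0::'b}))"
    by (intro open_Times open_chart_image[OF A d(1)]) auto
  then show "open S" unfolding S_def d(2) slit_chart_image[OF A d(1)] .
  show "snd k z \<in> S" "S \<subseteq> snd k ` fst k" using k z by (auto simp: S_def)
  show C: "Ck_on 2 S (in_chart k E)"
    using F k(1) unfolding S_def by (simp add: finsler_manifold_def manifold_smooth_on_def smooth_on_def)
  assume "x \<in> S"
  then obtain q where q: "q \<in> fst k" "q \<in> slit_bundle A" "x = snd k q" by (auto simp: S_def)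
  have "differential (tangent_atlas A) E q (liouville A q) = 2 * E q"
    using F q(2) by (simp add: finsler_manifold_def slit_bundle_def)
  moreover have "differential (tangent_atlas A) E q (liouville A q)
      = frechet_derivative (in_chart k E) (at (snd k q)) (liouville A q k)"
    by (rule differential_in_chart[OF T k(1) q(1) liouville_in_tangent_space[OF M]])
      (use Ck_on_2_differentiable(1)[OF C \<open>x \<in> S\<close>] q in simp)
  ultimately show "frechet_derivative (in_chart k E) (at x) (0, snd x) = 2 * in_chart k E x"
    using k(1) q by (simp add: in_chart_apply[OF T k(1)] liouville_def)
qed

text \<open>The hypothesis on \<open>w\<close> says that \<open>J w\<close> is the Liouville vector at \<open>z\<close>, as it is for the value of
  any spray. The two identities read \<open>\<omega>(v, w) = v E\<close> and \<open>\<omega>((d\<^bsub>[J, W]\<^esub> E)\<^sup>#, w) = 2 W E\<close>.\<close>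

lemma
  assumes F: "finsler_manifold M A E" and z: "z \<in> slit_bundle A"
  defines "k \<equiv> chart_at (tangent_atlas A) z"
  assumes w: "fst w = snd (snd k z)"
  shows fundamental_form_vertical: "vertical_vector v \<Longrightarrow>
      coordinate_form (in_chart k E) (snd k z) (v k) w = differential (tangent_atlas A) E z v"
    and fundamental_form_sharp_bracket: "vertical_field A W \<Longrightarrow> homogeneous_field_2 A W \<Longrightarrow>
      coordinate_form (in_chart k E) (snd k z)
        (sharp (tangent_atlas A) (fundamental_form A E)
          (differential_along (tangent_atlas A)
            (vector_form_bracket (tangent_atlas A) vertical_endo W) E) z k) w
      = 2 * differential (tangent_atlas A) E z (W z)"
proof -
  have M: "smooth_manifold M A" using F by (simp add: finsler_manifold_def)
  note T = tangent_atlas_differentiable[OF M]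
  define S where "S = snd k ` (fst k \<inter> slit_bundle A)"
  note chart = finsler_chart[OF F z, folded k_def, folded S_def]
  note k = chart(1,2) and S = chart(3,5,4) and C = chart(6)
  define D where "D = frechet_derivative (in_chart k E) (at (snd k z))"
  have D: "differential (tangent_atlas A) E z v = D (v k)" for v
    by (simp add: differential_def D_def k_def Let_def)
  have lin_D: "linear D"
    unfolding D_def by (rule linear_frechet_derivative[OF Ck_on_2_differentiable(1)[OF C S(3)]])
  show "coordinate_form (in_chart k E) (snd k z) (v k) w = differential (tangent_atlas A) E z v"
    if "vertical_vector v" for v
  proof -
    note v = vertical_vector_component[OF that, of k]
    have "coordinate_form (in_chart k E) (snd k z) (0, snd (v k)) w = D (0, snd (v k))"
      unfolding D_def by (rule coordinate_form_vertical[OF S(1,3) C chart(7) w])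
    then show ?thesis unfolding D by (simp only: v[symmetric])
  qed
  assume W: "vertical_field A W" "homogeneous_field_2 A W"
  define DW where "DW = frechet_derivative (in_chart k (\<lambda>q. W q k)) (at (snd k z))"
  have W_diff: "in_chart k (\<lambda>q. W q k) differentiable (at (snd k z))"
  proof -
    have "smooth_on S (in_chart k (\<lambda>q. W q k))"
      using W(1) k(1) by (simp add: S_def vertical_field_def smooth_vector_field_on_def)
    then show ?thesis
      using Ck_on_2_differentiable(1)[OF _ S(3)] unfolding smooth_on_def by blast
  qed
  have in_bundle: "q \<in> tangent_bundle A" if "q \<in> fst k" for q
    using that k(1) by (auto simp: tangent_atlas_def fst_tangent_chart)
  have bracket: "vector_form_bracket (tangent_atlas A) vertical_endo W z v k = DW (0, fst (v k))" for v
    unfolding DW_def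
    by (rule vertical_endo_bracket_in_chart[where V = W, OF M k meta_eq_to_obj_eq[OF k_def] S W_diff])
      (use W(1) in_bundle in \<open>simp add: vertical_field_def vertical_vector_def del: split_paired_All\<close>)
  have lin: "linear (\<lambda>h. D (DW (0, fst h)))"
  proof -
    have "linear DW" unfolding DW_def by (rule linear_frechet_derivative[OF W_diff])
    then have "linear (D \<circ> (DW \<circ> (Pair 0 \<circ> fst)))"
      by (intro linear_compose lin_D linear_fst linear_Pair_0_left)
    then show ?thesis by (simp only: o_def)
  qed
  have "coordinate_form (in_chart k E) (snd k z)
        (sharp (tangent_atlas A) (fundamental_form A E)
          (differential_along (tangent_atlas A)
            (vector_form_bracket (tangent_atlas A) vertical_endo W) E) z k) w = D (DW (0, fst w))"
  proof (rule sharp_works(2)[OF T k _ bilinear_coordinate_form[OF S(1,3) C] _ lin])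
    show "nondegenerate_at (tangent_atlas A) (fundamental_form A E) z"
      using F z by (simp add: finsler_manifold_def)
    show "fundamental_form A E z v w = coordinate_form (in_chart k E) (snd k z) (v k) (w k)" for v w
      by (rule fundamental_form_in_chart[OF M k meta_eq_to_obj_eq[OF k_def] S C])
    show "differential_along (tangent_atlas A) (vector_form_bracket (tangent_atlas A) vertical_endo W) E z v
        = D (DW (0, fst (v k)))" for v
      by (simp add: differential_along_def D bracket)
  qed
  also have "DW (0, fst w) = 2 *\<^sub>R W z k"
    unfolding w DW_def using W z
    by (intro homogeneous_field_2_in_chart[OF M k z]) (auto simp: vertical_field_def slit_bundle_def)
  also have "D (2 *\<^sub>R W z k) = 2 * differential (tangent_atlas A) E z (W z)"
    by (simp add: linear_cmul[OF lin_D] D)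
  finally show "coordinate_form (in_chart k E) (snd k z)
        (sharp (tangent_atlas A) (fundamental_form A E)
          (differential_along (tangent_atlas A)
            (vector_form_bracket (tangent_atlas A) vertical_endo W) E) z k) w
      = 2 * differential (tangent_atlas A) E z (W z)" .
qed

theorem proposition8:
  fixes M :: "'a topology"
    and A :: "('a, 'e::euclidean_space) chart set"
    and E lam :: "'a \<times> ('a, 'e) tvec \<Rightarrow> real"
    and V U :: "'a \<times> ('a, 'e) tvec \<Rightarrow> ('a \<times> ('a, 'e) tvec, 'e \<times> 'e) tvec"
  assumes "finsler_manifold M A E"
    and "vertical_field A V" and "homogeneous_field_2 A V"
    and "vertical_field A U" and "homogeneous_field_2 A U"
    and "projectively_related A (deformed_spray A E V) (deformed_spray A E U) lam"
  shows "\<forall>z\<in>slit_bundle A.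
    lam z = 3 * differential (tangent_atlas A) E z (\<lambda>c. V z c - U z c) / E z"
proof
  fix z assume z: "z \<in> slit_bundle A"
  define k where "k = chart_at (tangent_atlas A) z"
  let ?F = "in_chart k E" and ?d = "differential (tangent_atlas A) E z"
  let ?s = "\<lambda>W. sharp (tangent_atlas A) (fundamental_form A E)
      (differential_along (tangent_atlas A) (vector_form_bracket (tangent_atlas A) vertical_endo W) E) z k"
  \<comment> \<open>contraction of \<open>\<omega>\<close> in its second slot with the vector of components \<open>(y, 0)\<close>\<close>
  define h where "h v = coordinate_form ?F (snd k z) v (snd (snd k z), 0)" for v
  note chart = finsler_chart[OF assms(1) z, folded k_def]
  have "linear h"
    using bilinear_coordinate_form[OF chart(3,4,6)] unfolding bilinear_def h_def by blast
  note h = linear_add[OF \<open>linear h\<close>] linear_cmul[OF \<open>linear h\<close>]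
  note h_vertical = fundamental_form_vertical[OF assms(1) z, folded k_def,
      of "(snd (snd k z), 0)", folded h_def, simplified]
  note h_sharp = fundamental_form_sharp_bracket[OF assms(1) z, folded k_def,
      of "(snd (snd k z), 0)", folded h_def, simplified]
  have vert: "vertical_vector (V z)" "vertical_vector (U z)" "vertical_vector (liouville A z)"
    using assms(2,4) z by (auto simp: vertical_field_def slit_bundle_def vertical_vector_def liouville_def)
  have "?d (liouville A z) = 2 * E z" and "E z > 0"
    using assms(1) z unfolding finsler_manifold_def slit_bundle_def by blast+
  have "linear (frechet_derivative ?F (at (snd k z)))"
    by (rule linear_frechet_derivative[OF Ck_on_2_differentiable(1)[OF chart(6,4)]])
  then have diff: "?d (\<lambda>c. V z c - U z c) = ?d (V z) - ?d (U z)"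
    unfolding differential_def Let_def k_def[symmetric] by (rule linear_diff)
  have "deformed_spray A E V z k = deformed_spray A E U z k + lam z *\<^sub>R liouville A z k"
    using assms(6) z by (simp add: projectively_related_def)
  then have "2 *\<^sub>R V z k + 2 *\<^sub>R ?s V = 2 *\<^sub>R U z k + 2 *\<^sub>R ?s U + lam z *\<^sub>R liouville A z k"
    by (simp add: deformed_spray_def add.assoc)
  from arg_cong[where f = h, OF this]
  have "2 * h (V z k) + 2 * h (?s V) = 2 * h (U z k) + 2 * h (?s U) + lam z * h (liouville A z k)"
    by (simp add: h)
  then have "2 * ?d (V z) + 2 * (2 * ?d (V z)) = 2 * ?d (U z) + 2 * (2 * ?d (U z)) + lam z * (2 * E z)"
    by (simp only: h_vertical[OF vert(1)] h_vertical[OF vert(2)] h_vertical[OF vert(3)]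
        h_sharp[OF assms(2,3)] h_sharp[OF assms(4,5)] \<open>?d (liouville A z) = 2 * E z\<close>)
  then show "lam z = 3 * ?d (\<lambda>c. V z c - U z c) / E z"
    using \<open>E z > 0\<close> by (simp add: diff field_simps)
qed

end
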